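(* Let $A$, $B$, $A+B$, $\mathbb{X}$, $\mathbb{Y}$ and $\mathbb{Z}$ be positive stable matrices in $\mathbb{C}^{r\times r}$. Then the new extended beta matrix function $\mathfrak{B}_{\mathbb{Y}}^{(A,B)}(\mathbb{X},\mathbb{Z})$ has the integral representation $$\mathfrak{B}_{\mathbb{Y}}^{(A,B)}(\mathbb{X},\mathbb{Z})=\int_0^\infty {}_1F_1\!\left(A;B;-2\mathbb{Y}-\mathbb{Y}\left(u+\frac1u\right)\right)u^{\mathbb{X}-I}(1+u)^{-(\mathbb{X}+\mathbb{Z})}\,du .$$
   Context: A matrix in $\mathbb{C}^{r\times r}$ is positive stable if all its eigenvalues have positive real part; $I$ is the identity matrix. For $t>0$ and a square matrix $M$, $t^M=\exp(M\ln t)$. The Pochhammer symbol is $(M)_0=I$, $(M)_n=M(M+I)\cdots(M+(n-1)I)$ for $n\ge1$. For positive stable $B$ and a square matrix $W$, ${}_1F_1(A;B;W)=\sum_{n\ge0}(A)_n\,[(B)_n]^{-1}\,\frac{W^n}{n!}$. For positive stable $A,B,\mathbb{X},\mathbb{Y},\mathbb{Z}$ in $\mathbb{C}^{r\times r}$ the new extended beta matrix function is defined as $$\mathfrak{B}_{\mathbb{Y}}^{(A,B)}(\mathbb{X},\mathbb{Z})=\int_0^1 {}_1F_1\!\left(A;B;-\frac{\mathbb{Y}}{t(1-t)}\right)t^{\mathbb{X}-I}(1-t)^{\mathbb{Z}-I}\,dt .$$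
   Formalization: It is additionally assumed that 𝕏 and ℤ commute; without this the identity fails, e.g. for r=3, A=B=𝕐=I, 𝕏=I+E₁₂, ℤ=I+E₂₃, where the (1,3) entries of the two sides differ. *)

theory Defs
  imports "HOL-Analysis.Analysis"
begin

text \<open>
  The class instance of multiplication on \<^typ>\<open>complex^'r^'r\<close> is componentwise, so the library
  constants for powers and the exponential do not denote the matrix power and the matrix exponential.
  Everything below is built on the matrix product \<open>**\<close>; the identity matrix is \<open>mat 1\<close>.
\<close>

definition positive_stable :: "complex^'r^'r \<Rightarrow> bool" where
  "positive_stable M \<longleftrightarrow> (\<forall>c. (\<exists>v. v \<noteq> 0 \<and> M *v v = c *s v) \<longrightarrow> Re c > 0)"

primrec mat_pow :: "complex^'r^'r \<Rightarrow> nat \<Rightarrow> complex^'r^'r" where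
  "mat_pow M 0 = mat 1"
| "mat_pow M (Suc n) = mat_pow M n ** M"

definition mat_exp :: "complex^'r^'r \<Rightarrow> complex^'r^'r" where
  "mat_exp M = (\<Sum>n. (1 / fact n) *\<^sub>R mat_pow M n)"

text \<open>The power \<open>t\<^sup>M\<close>, meant for \<open>t > 0\<close>.\<close>

definition mat_powr :: "real \<Rightarrow> complex^'r^'r \<Rightarrow> complex^'r^'r" where
  "mat_powr t M = mat_exp (ln t *\<^sub>R M)"

primrec mat_pochhammer :: "complex^'r^'r \<Rightarrow> nat \<Rightarrow> complex^'r^'r" where
  "mat_pochhammer M 0 = mat 1"
| "mat_pochhammer M (Suc n) = mat_pochhammer M n ** (M + mat (of_nat n))"

text \<open>
  Meant for positive stable \<open>B\<close>: then every \<open>B + mat (of_nat n)\<close>, hence every \<open>mat_pochhammer B n\<close>,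
  is invertible. No two of \<open>A\<close>, \<open>B\<close>, \<open>W\<close> are assumed to commute, so the order of factors matters.
\<close>

definition mat_1F1 :: "complex^'r^'r \<Rightarrow> complex^'r^'r \<Rightarrow> complex^'r^'r \<Rightarrow> complex^'r^'r" where
  "mat_1F1 A B W =
     (\<Sum>n. mat_pochhammer A n ** matrix_inv (mat_pochhammer B n) ** ((1 / fact n) *\<^sub>R mat_pow W n))"

definition extended_beta ::
  "complex^'r^'r \<Rightarrow> complex^'r^'r \<Rightarrow> complex^'r^'r \<Rightarrow> complex^'r^'r \<Rightarrow> complex^'r^'r \<Rightarrow> complex^'r^'r" where
  "extended_beta A B Y X Z =
     (LINT t:{0<..<1}|lborel.
        mat_1F1 A B (- ((1 / (t * (1 - t))) *\<^sub>R Y)) **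
        mat_powr t (X - mat 1) ** mat_powr (1 - t) (Z - mat 1))"

end

theory Submission
  imports Defs
begin

text \<open>
  Substitute \<open>t = u / (1 + u)\<close>. Then \<open>1 / (t (1 - t)) = 2 + u + 1 / u\<close>, and since \<open>X\<close> and \<open>Z\<close>
  commute, the powers of \<open>1 + u\<close> combine to \<open>(1 + u) powr (2 I - X - Z)\<close>, whose factor
  \<open>(1 + u)\<^sup>2\<close> cancels the Jacobian.
\<close>

section \<open>Bilinearity of the matrix product and measurability of matrix functions\<close>

lemma bounded_bilinear_matrix_matrix_mult:
  "bounded_bilinear ((**) :: complex^'n^'m \<Rightarrow> complex^'p^'n \<Rightarrow> complex^'p^'m)"
  unfolding bilinear_conv_bounded_bilinear [symmetric] bilinear_def
  by (auto intro!: linearI simp: vec_eq_iff matrix_matrix_mult_def sum.distrib algebra_simps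
      scaleR_sum_right)

lemmas matrix_mult_bilinear = bounded_bilinear_matrix_matrix_mult
  [THEN bounded_bilinear.add_left]
  bounded_bilinear_matrix_matrix_mult [THEN bounded_bilinear.add_right]
  bounded_bilinear_matrix_matrix_mult [THEN bounded_bilinear.diff_left]
  bounded_bilinear_matrix_matrix_mult [THEN bounded_bilinear.diff_right]
  bounded_bilinear_matrix_matrix_mult [THEN bounded_bilinear.scaleR_left]
  bounded_bilinear_matrix_matrix_mult [THEN bounded_bilinear.scaleR_right]

lemma borel_measurable_matrix_mult [measurable (raw)]:
  fixes f :: "'a \<Rightarrow> complex^'n^'m" and g :: "'a \<Rightarrow> complex^'p^'n"
  assumes "f \<in> borel_measurable M" and "g \<in> borel_measurable M"
  shows "(\<lambda>x. f x ** g x) \<in> borel_measurable M"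
  using assms
  by (rule borel_measurable_continuous_Pair)
    (intro bounded_bilinear.continuous_on [OF bounded_bilinear_matrix_matrix_mult]
      continuous_intros)

lemma borel_measurable_mat_pow [measurable (raw)]:
  fixes f :: "'a \<Rightarrow> complex^'r^'r"
  assumes [measurable]: "f \<in> borel_measurable M"
  shows "(\<lambda>x. mat_pow (f x) n) \<in> borel_measurable M"
  by (induction n) simp_all

lemma borel_measurable_mat_exp [measurable (raw)]:
  fixes f :: "'a \<Rightarrow> complex^'r^'r"
  assumes [measurable]: "f \<in> borel_measurable M"
  shows "(\<lambda>x. mat_exp (f x)) \<in> borel_measurable M"
  unfolding mat_exp_def by measurable

text \<open>A \<open>suminf\<close> of measurable terms is measurable whether or not it converges,
  so it is enough that each term depends measurably on the argument through
  \<open>mat_pow\<close>.\<close>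

lemma borel_measurable_mat_1F1 [measurable (raw)]:
  fixes f :: "'a \<Rightarrow> complex^'r^'r"
  assumes [measurable]: "f \<in> borel_measurable M"
  shows "(\<lambda>x. mat_1F1 A B (f x)) \<in> borel_measurable M"
  unfolding mat_1F1_def by measurable

lemma borel_measurable_mat_powr [measurable (raw)]:
  assumes [measurable]: "f \<in> borel_measurable M"
  shows "(\<lambda>x. mat_powr (f x) X) \<in> borel_measurable M"
  unfolding mat_powr_def by measurable

section \<open>The matrix exponential of a sum of commuting matrices\<close>

text \<open>The series is dominated by a multiple of the real exponential series at
  \<open>norm M * K\<close>, where \<open>K\<close> is the bound of the bilinear matrix
  product.\<close>

lemma mat_exp_series_abs_summable:
  fixes M :: "complex^'r^'r"
  shows "summable (\<lambda>n. norm ((1 / fact n) *\<^sub>R mat_pow M n))"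
proof -
  obtain K where K: "K > 0" "\<And>(A :: complex^'r^'r) (B :: complex^'r^'r). norm (A ** B) \<le> norm A * norm B * K"
    using bounded_bilinear.pos_bounded [OF bounded_bilinear_matrix_matrix_mult] by blast
  \<comment> \<open>The factor \<open>norm (mat 1)\<close> comes from the case \<open>n = 0\<close>:
    the norm is Euclidean in the entries, so the identity need not have norm 1.\<close>
  have bound: "norm (mat_pow M n) \<le> norm (mat 1 :: complex^'r^'r) * (norm M * K) ^ n" for n
  proof (induction n)
    case (Suc n)
    have "norm (mat_pow M (Suc n)) \<le> norm (mat_pow M n) * (norm M * K)"
      using K(2) [of "mat_pow M n" M] by (simp add: mult.assoc)
    also have "\<dots> \<le> (norm (mat 1 :: complex^'r^'r) * (norm M * K) ^ n) * (norm M * K)"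
      using Suc K(1) by (intro mult_right_mono) auto
    finally show ?case by (simp add: mult_ac)
  qed simp
  have "summable (\<lambda>n. norm (mat 1 :: complex^'r^'r) * (inverse (fact n) * (norm M * K) ^ n))"
    by (intro summable_mult summable_exp)
  then show ?thesis
    by (rule summable_comparison_test') (use bound in \<open>auto simp: field_simps\<close>)
qed

text \<open>Unconditional summation is the form that permits rearranging the double series in the
  product formula.\<close>

lemma mat_exp_has_sum:
  "((\<lambda>n. (1 / fact n) *\<^sub>R mat_pow M n) has_sum mat_exp M) UNIV"
  unfolding mat_exp_def
  by (intro norm_summable_imp_has_sum mat_exp_series_abs_summable summable_sums
      summable_norm_cancel [OF mat_exp_series_abs_summable])

lemma mat_pow_commute:
  fixes A B :: "complex^'r^'r"
  assumes "A ** B = B ** A"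
  shows "mat_pow A n ** B = B ** mat_pow A n"
proof (induction n)
  case (Suc n)
  have "mat_pow A (Suc n) ** B = (mat_pow A n ** B) ** A"
    by (simp add: assms flip: matrix_mul_assoc)
  then show ?case by (simp add: Suc matrix_mul_assoc)
qed simp

text \<open>This is the binomial theorem divided by \<open>fact n\<close>. Binomial coefficients are
  avoided by the recursion \<open>S_Suc\<close>: multiplying by \<open>M\<close> raises the index
  and produces the weight \<open>Suc n\<close>, so the induction proves \<open>Suc n\<close> times
  the claim.\<close>

lemma mat_exp_series_add_commuting:
  fixes A B :: "complex^'r^'r"
  assumes comm: "A ** B = B ** A"
  defines "S \<equiv> \<lambda>M n. (1 / fact n) *\<^sub>R mat_pow (M :: complex^'r^'r) n"
  shows "S (A + B) n = (\<Sum>i\<le>n. S A i ** S B (n - i))"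
proof (induction n)
  case 0
  show ?case by (simp add: S_def)
next
  case (Suc n)
  have S_Suc: "S M n ** M = real (Suc n) *\<^sub>R S M (Suc n)" for M n
    by (simp add: S_def matrix_mult_bilinear)
  have S_comm: "S B n ** A = A ** S B n" for n
    using mat_pow_commute [OF comm [symmetric]] by (simp add: S_def matrix_mult_bilinear)
  have "real (Suc n) *\<^sub>R S (A + B) (Suc n) = (\<Sum>i\<le>n. S A i ** S B (n - i)) ** (A + B)"
    by (simp only: S_Suc [symmetric] Suc)
  also have "\<dots> = (\<Sum>i\<le>n. S A i ** S B (n - i) ** A) + (\<Sum>i\<le>n. S A i ** S B (n - i) ** B)"
    by (simp add: matrix_mult_bilinear
        bounded_bilinear.sum_left [OF bounded_bilinear_matrix_matrix_mult])
  \<comment> \<open>\<open>A\<close> is moved left past the powers of \<open>B\<close> and absorbed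
    into \<open>S A i\<close>; in the other sum \<open>B\<close> is absorbed directly.\<close>
  also have "(\<Sum>i\<le>n. S A i ** S B (n - i) ** A)
      = (\<Sum>i\<le>n. real (Suc i) *\<^sub>R (S A (Suc i) ** S B (n - i)))"
    by (intro sum.cong refl)
      (metis S_comm S_Suc matrix_mul_assoc matrix_mult_bilinear(5))
  also have "(\<Sum>i\<le>n. S A i ** S B (n - i) ** B)
      = (\<Sum>i\<le>n. real (Suc n - i) *\<^sub>R (S A i ** S B (Suc n - i)))"
    by (intro sum.cong refl)
      (metis S_Suc matrix_mul_assoc matrix_mult_bilinear(6) Suc_diff_le atMost_iff)
  \<comment> \<open>Both sums are extended to the range up to \<open>Suc n\<close>: the new term has
    weight 0, at \<open>i = 0\<close> here and at \<open>i = Suc n\<close> in the next step. The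
    weights \<open>i\<close> and \<open>Suc n - i\<close> then add up to
    \<open>Suc n\<close>.\<close>
  also have "(\<Sum>i\<le>n. real (Suc i) *\<^sub>R (S A (Suc i) ** S B (n - i)))
      = (\<Sum>i\<le>Suc n. real i *\<^sub>R (S A i ** S B (Suc n - i)))"
    by (subst sum.atMost_Suc_shift) simp
  also have "(\<Sum>i\<le>n. real (Suc n - i) *\<^sub>R (S A i ** S B (Suc n - i)))
      = (\<Sum>i\<le>Suc n. real (Suc n - i) *\<^sub>R (S A i ** S B (Suc n - i)))"
    by simp
  also have "(\<Sum>i\<le>Suc n. real i *\<^sub>R (S A i ** S B (Suc n - i)))
        + (\<Sum>i\<le>Suc n. real (Suc n - i) *\<^sub>R (S A i ** S B (Suc n - i)))
      = (\<Sum>i\<le>Suc n. real (Suc n) *\<^sub>R (S A i ** S B (Suc n - i)))"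
    unfolding sum.distrib [symmetric] scaleR_add_left [symmetric] of_nat_add [symmetric]
    by (intro sum.cong) auto
  also have "\<dots> = real (Suc n) *\<^sub>R (\<Sum>i\<le>Suc n. S A i ** S B (Suc n - i))"
    by (simp only: scaleR_sum_right)
  finally show ?case
    by (simp only: scaleR_cancel_left) simp
qed

text \<open>Cauchy product: the double family \<open>S A i ** S B j\<close> is summed once by rows,
  giving the product of exponentials, and once along the antidiagonals, giving the exponential
  series of \<open>A + B\<close>.\<close>

lemma mat_exp_add_commuting:
  fixes A B :: "complex^'r^'r"
  assumes "A ** B = B ** A"
  shows "mat_exp (A + B) = mat_exp A ** mat_exp B"
proof -
  define S where "S M n = (1 / fact n) *\<^sub>R mat_pow (M :: complex^'r^'r) n" for M n
  have sum: "(S M has_sum mat_exp M) UNIV" for M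
    using mat_exp_has_sum unfolding S_def .
  have abs: "(\<lambda>n. norm (S M n)) summable_on UNIV" for M
    using mat_exp_series_abs_summable [of M] unfolding S_def
    by (intro norm_summable_imp_summable_on) simp
  obtain K where K: "K > 0" "\<And>(A :: complex^'r^'r) (B :: complex^'r^'r). norm (A ** B) \<le> norm A * norm B * K"
    using bounded_bilinear.pos_bounded [OF bounded_bilinear_matrix_matrix_mult] by blast
  \<comment> \<open>Absolute summability over all pairs justifies the regrouping; up to the constant
    \<open>K\<close> it follows from the product of two convergent real series.\<close>
  have "(\<lambda>(i, j). norm (S A i) * norm (S B j)) summable_on UNIV \<times> UNIV"
  proof (rule summable_on_SigmaI)
    show "((\<lambda>j. case (i, j) of (i, j) \<Rightarrow> norm (S A i) * norm (S B j))
        has_sum norm (S A i) * (\<Sum>\<^sub>\<infinity>j. norm (S B j))) UNIV" for i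
      using abs by (auto intro: has_sum_cmult_right)
    show "(\<lambda>i. norm (S A i) * (\<Sum>\<^sub>\<infinity>j. norm (S B j))) summable_on UNIV"
      by (intro summable_on_cmult_left abs)
  qed auto
  then have "(\<lambda>x. K * (case x of (i, j) \<Rightarrow> norm (S A i) * norm (S B j))) summable_on UNIV \<times> UNIV"
    by (rule summable_on_cmult_right)
  then have "(\<lambda>x. norm (case x of (i, j) \<Rightarrow> S A i ** S B j)) summable_on UNIV \<times> UNIV"
    by (rule Infinite_Sum.abs_summable_on_comparison_test')
      (use K(2) in \<open>auto simp: mult_ac\<close>)
  then have prod: "(\<lambda>(i, j). S A i ** S B j) summable_on UNIV \<times> UNIV"
    by (rule abs_summable_summable)
  have iter: "((\<lambda>(i, j). S A i ** S B j) has_sum mat_exp A ** mat_exp B) (UNIV \<times> UNIV)"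
  proof (rule has_sum_SigmaI)
    show "((\<lambda>j. case (i, j) of (i, j) \<Rightarrow> S A i ** S B j) has_sum S A i ** mat_exp B) UNIV" for i
      using has_sum_bounded_linear [OF bounded_bilinear.bounded_linear_right
          [OF bounded_bilinear_matrix_matrix_mult] sum] by (simp add: o_def)
    show "((\<lambda>i. S A i ** mat_exp B) has_sum mat_exp A ** mat_exp B) UNIV"
      by (rule has_sum_bounded_linear [OF bounded_bilinear.bounded_linear_left
          [OF bounded_bilinear_matrix_matrix_mult] sum, unfolded o_def])
  qed (rule prod)
  \<comment> \<open>The pair \<open>(i, j)\<close> is relabelled by its antidiagonal
    \<open>n = i + j\<close> and its first entry, so each inner sum becomes finite.\<close>
  have "((\<lambda>(n, i). S A i ** S B (n - i)) has_sum mat_exp A ** mat_exp B) (SIGMA n:UNIV. {..n})"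
    using iter
    by (subst has_sum_reindex_bij_witness
        [where i = "\<lambda>(i, j). (i + j, i)" and j = "\<lambda>(n, i). (i, n - i)" and T = "UNIV \<times> UNIV"
          and h = "\<lambda>(i, j). S A i ** S B j" and s' = "mat_exp A ** mat_exp B"]) auto
  then have "((\<lambda>n. \<Sum>i\<le>n. S A i ** S B (n - i)) has_sum mat_exp A ** mat_exp B) UNIV"
    by (rule has_sum_SigmaD) (auto intro: has_sum_finite)
  then have "(S (A + B) has_sum mat_exp A ** mat_exp B) UNIV"
    using mat_exp_series_add_commuting [OF assms] by (simp add: S_def [abs_def])
  then show ?thesis
    by (rule has_sum_unique [OF sum])
qed

lemma mat_exp_scaleR_mat_1: "mat_exp (c *\<^sub>R mat 1 :: complex^'r^'r) = exp c *\<^sub>R mat 1"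
proof -
  have pow: "mat_pow (c *\<^sub>R mat 1 :: complex^'r^'r) n = c ^ n *\<^sub>R mat 1" for n
    by (induction n) (simp_all add: matrix_mult_bilinear mult.commute)
  have "(\<lambda>n. (c ^ n /\<^sub>R fact n) *\<^sub>R mat 1) sums (exp c *\<^sub>R (mat 1 :: complex^'r^'r))"
    by (intro sums_scaleR_left exp_converges)
  then show ?thesis
    unfolding mat_exp_def pow by (simp add: sums_iff divide_inverse mult.commute)
qed

section \<open>The matrix powers under the substitution\<close>

lemma mat_powr_beta_substitution:
  fixes X Z :: "complex^'r^'r"
  assumes "X ** Z = Z ** X" and "u > 0"
  shows "mat_powr (u / (1 + u)) (X - mat 1) ** mat_powr (1 / (1 + u)) (Z - mat 1)
    = (1 + u)\<^sup>2 *\<^sub>R (mat_powr u (X - mat 1) ** mat_powr (1 + u) (- (X + Z)))"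
proof -
  define m where "m = ln (1 + u)"
  have ln: "ln (u / (1 + u)) = ln u - m" "ln (1 / (1 + u)) = - m"
    using assms(2) by (simp_all add: m_def ln_div)
  have "mat_powr (u / (1 + u)) (X - mat 1) ** mat_powr (1 / (1 + u)) (Z - mat 1)
      = mat_exp ((ln u - m) *\<^sub>R (X - mat 1) + (- m) *\<^sub>R (Z - mat 1))"
    unfolding mat_powr_def ln
    by (rule mat_exp_add_commuting [symmetric]) (simp add: matrix_mult_bilinear assms algebra_simps)
  \<comment> \<open>Each of the two \<open>- mat 1\<close> contributes one \<open>m\<close> to the
    scalar part, whose exponential is \<open>(1 + u)\<^sup>2\<close>. The splittings that follow are
    legitimate because \<open>X\<close> commutes with \<open>X + Z\<close> and scalar matrices
    commute with everything.\<close>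
  also have "(ln u - m) *\<^sub>R (X - mat 1) + (- m) *\<^sub>R (Z - mat 1)
      = ln u *\<^sub>R (X - mat 1) + (m *\<^sub>R (- (X + Z)) + (2 * m) *\<^sub>R mat 1)"
    by (simp add: vec_eq_iff scaleR_conv_of_real algebra_simps)
  also have "mat_exp \<dots> = mat_powr u (X - mat 1) ** mat_exp (m *\<^sub>R (- (X + Z)) + (2 * m) *\<^sub>R mat 1)"
    unfolding mat_powr_def
    by (rule mat_exp_add_commuting) (simp add: matrix_mult_bilinear assms algebra_simps)
  also have "mat_exp (m *\<^sub>R (- (X + Z)) + (2 * m) *\<^sub>R mat 1)
      = mat_powr (1 + u) (- (X + Z)) ** mat_exp ((2 * m) *\<^sub>R mat 1)"
    unfolding mat_powr_def m_def
    by (rule mat_exp_add_commuting)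
      (simp only: matrix_mult_bilinear matrix_mul_lid matrix_mul_rid scaleR_left_commute)
  also have "mat_exp ((2 * m) *\<^sub>R (mat 1 :: complex^'r^'r)) = (1 + u)\<^sup>2 *\<^sub>R mat 1"
    using assms(2) by (simp add: mat_exp_scaleR_mat_1 m_def exp_double)
  finally show ?thesis
    by (simp add: matrix_mult_bilinear)
qed

section \<open>Change of variables for vector-valued Bochner integrals\<close>

text \<open>Change of variables as an identity of measures, so that it carries over to integrands
  with values in a Banach space. On a Borel set \<open>A\<close> it is the real-valued theorem
  applied to the indicator of \<open>A\<close>.\<close>

lemma distr_density_substitution:
  fixes g g' :: "real \<Rightarrow> real"
  assumes [measurable]: "S \<in> sets borel" "g ` S \<in> sets borel"
      "g \<in> borel_measurable borel" "g' \<in> borel_measurable borel"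
    and fin: "emeasure lborel (g ` S) < \<infinity>"
    and deriv: "\<And>x. x \<in> S \<Longrightarrow> (g has_field_derivative g' x) (at x within S)"
    and inj: "inj_on g S"
  shows "distr (density lborel (\<lambda>x. ennreal (indicator S x * \<bar>g' x\<bar>))) borel g
    = density lborel (\<lambda>y. ennreal (indicator (g ` S) y))"
proof (rule measure_eqI)
  fix A assume "A \<in> sets (distr (density lborel (\<lambda>x. ennreal (indicator S x * \<bar>g' x\<bar>))) borel g)"
  then have [measurable]: "A \<in> sets borel" by simp
  have [measurable]: "g -` A \<in> sets borel"
    by (rule measurable_sets_borel) measurable
  \<comment> \<open>Finiteness of the image makes the indicator of \<open>A\<close> integrable on
    it, so the theorem for absolutely integrable functions applies.\<close>
  have fin': "emeasure lborel (A \<inter> g ` S) < \<infinity>"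
    by (rule le_less_trans [OF emeasure_mono fin]) auto
  then have "((\<lambda>x. 1 :: real) has_integral measure lborel (A \<inter> g ` S)) (A \<inter> g ` S)"
    by (intro has_integral_measure_lborel) auto
  then have *: "(indicat_real A has_integral measure lborel (A \<inter> g ` S)) (g ` S)"
    unfolding has_integral_restrict_Int [symmetric] indicator_def of_bool_def .
  then have "indicat_real A absolutely_integrable_on g ` S"
    by (intro nonnegative_absolutely_integrable_1) auto
  with * have "(\<lambda>x. \<bar>g' x\<bar> * indicat_real A (g x)) absolutely_integrable_on S \<and>
      integral S (\<lambda>x. \<bar>g' x\<bar> * indicat_real A (g x)) = measure lborel (A \<inter> g ` S)"
    by (subst has_absolute_integral_change_of_variables_1' [OF _ deriv inj])
      (auto simp: integral_unique)
  \<comment> \<open>The integrand is nonnegative, so its gauge integral equals the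
    \<open>nn_integral\<close> that defines the measure of \<open>A\<close> under the
    pushforward.\<close>
  then have "((\<lambda>x. \<bar>g' x\<bar> * indicat_real A (g x)) has_integral measure lborel (A \<inter> g ` S)) S"
    using set_lebesgue_integral_eq_integral(1) has_integral_iff by blast
  then have "(\<integral>\<^sup>+x. indicator S x * (\<bar>g' x\<bar> * indicat_real A (g x)) \<partial>lborel)
      = measure lborel (A \<inter> g ` S)"
    by (intro nn_integral_has_integral_lebesgue) auto
  moreover have "emeasure (distr (density lborel (\<lambda>x. ennreal (indicator S x * \<bar>g' x\<bar>))) borel g) A
      = (\<integral>\<^sup>+x. indicator S x * (\<bar>g' x\<bar> * indicat_real A (g x)) \<partial>lborel)"
    by (auto simp: emeasure_distr emeasure_density intro!: nn_integral_cong split: split_indicator)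
  moreover have "emeasure (density lborel (\<lambda>y. ennreal (indicator (g ` S) y))) A
      = emeasure lborel (A \<inter> g ` S)"
    by (simp add: emeasure_density ennreal_indicator Int_commute flip: indicator_inter_arith)
  ultimately show "emeasure (distr (density lborel (\<lambda>x. ennreal (indicator S x * \<bar>g' x\<bar>))) borel g) A
      = emeasure (density lborel (\<lambda>y. ennreal (indicator (g ` S) y))) A"
    using fin' by (simp add: emeasure_eq_ennreal_measure)
qed simp

text \<open>
  No integrability is assumed: both sides are Bochner integrals of one function with respect to
  equal measures, and they vanish together when that function is not integrable.
\<close>

lemma set_lebesgue_integral_substitution:
  fixes g g' :: "real \<Rightarrow> real" and f :: "real \<Rightarrow> 'a::{banach, second_countable_topology}"
  assumes [measurable]: "S \<in> sets borel" "g ` S \<in> sets borel"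
      "g \<in> borel_measurable borel" "g' \<in> borel_measurable borel" "f \<in> borel_measurable borel"
    and "emeasure lborel (g ` S) < \<infinity>"
    and "\<And>x. x \<in> S \<Longrightarrow> (g has_field_derivative g' x) (at x within S)"
    and "inj_on g S"
  shows "(LINT y:g ` S|lborel. f y) = (LINT x:S|lborel. \<bar>g' x\<bar> *\<^sub>R f (g x))"
proof -
  have "(LINT y:g ` S|lborel. f y) = integral\<^sup>L (density lborel (\<lambda>y. ennreal (indicator (g ` S) y))) f"
    unfolding set_lebesgue_integral_def by (subst integral_density) auto
  also have "\<dots> = integral\<^sup>L (density lborel (\<lambda>x. ennreal (indicator S x * \<bar>g' x\<bar>))) (\<lambda>x. f (g x))"
    by (subst distr_density_substitution [symmetric, where g' = g'])
      (use assms in \<open>auto simp: integral_distr\<close>)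
  also have "\<dots> = (LINT x:S|lborel. \<bar>g' x\<bar> *\<^sub>R f (g x))"
    unfolding set_lebesgue_integral_def by (subst integral_density) auto
  finally show ?thesis .
qed

section \<open>The integral representation\<close>

lemma image_divide_1_plus: "(\<lambda>u::real. u / (1 + u)) ` {0<..} = {0<..<1}"
proof (intro equalityI subsetI)
  fix t :: real assume "t \<in> {0<..<1}"
  then show "t \<in> (\<lambda>u. u / (1 + u)) ` {0<..}"
    \<comment> \<open>The witness is the inverse map of \<open>u / (1 + u)\<close>.\<close>
    by (intro image_eqI [where x = "t / (1 - t)"]) (auto simp: field_simps)
qed auto

theorem theorem3p2:
  fixes A B X Y Z :: "complex^'r^'r"
  assumes "positive_stable A" and "positive_stable B" and "positive_stable (A + B)"
    and "positive_stable X" and "positive_stable Y" and "positive_stable Z"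
    and "X ** Z = Z ** X"
  shows "extended_beta A B Y X Z =
    (LINT u:{0<..}|lborel.
       mat_1F1 A B (- (2 *\<^sub>R Y) - (u + 1 / u) *\<^sub>R Y) **
       mat_powr u (X - mat 1) ** mat_powr (1 + u) (- (X + Z)))"
proof -
  define F where "F t = mat_1F1 A B (- ((1 / (t * (1 - t))) *\<^sub>R Y)) **
      mat_powr t (X - mat 1) ** mat_powr (1 - t) (Z - mat 1)" for t
  define g :: "real \<Rightarrow> real" where "g u = u / (1 + u)" for u
  define g' :: "real \<Rightarrow> real" where "g' u = 1 / (1 + u)\<^sup>2" for u
  have [measurable]: "F \<in> borel_measurable borel" "g \<in> borel_measurable borel"
      "g' \<in> borel_measurable borel"
    unfolding F_def g_def g'_def by measurable
  have img: "g ` {0<..} = {0<..<1}"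
    unfolding g_def by (rule image_divide_1_plus)
  have deriv: "(g has_field_derivative g' u) (at u within {0<..})" if "u \<in> {0<..}" for u
    unfolding g_def g'_def using that
    by (auto intro!: derivative_eq_intros simp: power2_eq_square)
  have inj: "inj_on g {0<..}"
    by (auto simp: inj_on_def g_def field_simps)
  \<comment> \<open>The unit interval is taken as the image of the half-line, not conversely, since
    the substitution lemma asks for an image of finite measure.\<close>
  have "extended_beta A B Y X Z = (LINT t:g ` {0<..}|lborel. F t)"
    by (simp add: extended_beta_def F_def img)
  also have "\<dots> = (LINT u:{0<..}|lborel. \<bar>g' u\<bar> *\<^sub>R F (g u))"
    by (rule set_lebesgue_integral_substitution [OF _ _ _ _ _ _ deriv inj]) (simp_all add: img)
  also have "\<dots> = (LINT u:{0<..}|lborel.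
       mat_1F1 A B (- (2 *\<^sub>R Y) - (u + 1 / u) *\<^sub>R Y) **
       mat_powr u (X - mat 1) ** mat_powr (1 + u) (- (X + Z)))"
  proof (intro set_lebesgue_integral_cong allI impI)
    fix u :: real assume "u \<in> {0<..}"
    then have u: "u > 0" by simp
    have g1: "1 - g u = 1 / (1 + u)"
      using u by (simp add: g_def field_simps)
    have "1 / (g u * (1 - g u)) = 2 + (u + 1 / u)"
      unfolding g1 using u by (simp add: g_def field_simps)
    then have arg: "- ((1 / (g u * (1 - g u))) *\<^sub>R Y) = - (2 *\<^sub>R Y) - (u + 1 / u) *\<^sub>R Y"
      by (simp only: scaleR_add_left) simp
    \<comment> \<open>Reassociation isolates the two powers and leaves the \<open>mat_1F1\<close>
      factor in place on the left, as it is not assumed to commute with them.\<close>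
    have "F (g u) = mat_1F1 A B (- (2 *\<^sub>R Y) - (u + 1 / u) *\<^sub>R Y) **
        (mat_powr (g u) (X - mat 1) ** mat_powr (1 - g u) (Z - mat 1))"
      unfolding F_def arg by (simp only: matrix_mul_assoc)
    \<comment> \<open>The hypothesis \<open>X ** Z = Z ** X\<close> enters here.\<close>
    also have "mat_powr (g u) (X - mat 1) ** mat_powr (1 - g u) (Z - mat 1)
        = (1 + u)\<^sup>2 *\<^sub>R (mat_powr u (X - mat 1) ** mat_powr (1 + u) (- (X + Z)))"
      unfolding g1 unfolding g_def using assms(7) u by (rule mat_powr_beta_substitution)
    finally show "\<bar>g' u\<bar> *\<^sub>R F (g u) = mat_1F1 A B (- (2 *\<^sub>R Y) - (u + 1 / u) *\<^sub>R Y) **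
       mat_powr u (X - mat 1) ** mat_powr (1 + u) (- (X + Z))"
      using u by (simp add: g'_def matrix_mult_bilinear matrix_mul_assoc)
  qed simp
  finally show ?thesis .
qed

end
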